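(* Let $\mathbb{F}_q$ be any finite field, and let $M$ be any non-free, $\mathbb{F}_q$-representable matroid. If $m:\mathbb{N}\to\mathbb{N}$ satisfies $m(n)\geq n$ for all sufficiently large $n$, then $$\limsup_{n\to\infty}\mathbb{P}_{A_n\sim[U_q]^{m(n)\times n}}\{M \text{ is a minor of } M[A_n]\}\leq 1-C_q,$$ where $C_q=\prod_{k=1}^{\infty}\left(1-q^{-k}\right)$.
   Context: $\mathbb{F}_q$ is the finite field with $q$ elements. $[U_q]^{m\times n}$ denotes the uniform distribution on $\mathbb{F}_q^{m\times n}$ (entries i.i.d. uniform on $\mathbb{F}_q$), and $A \sim [U_q]^{m \times n}$ means that $A$ is drawn from it. For a matrix $A$ over $\mathbb{F}_q$ with $n$ columns, $M[A]$ is the column dependence matroid of $A$: its ground set is the set of column indices $\{1,\dots,n\}$, and a set of indices is independent iff the corresponding columns form a linearly independent family. All matroids are finite. A matroid is $\mathbb{F}_q$-representable if it is isomorphic to $M[A]$ for some matrix $A$ over $\mathbb{F}_q$. A matroid is free if every subset of its ground set is independent, and non-free otherwise. "$M$ is a minor of $N$" means that $M$ is isomorphic to a matroid obtained from $N$ by a sequence of deletions and contractions. *)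

theory Defs
  imports "HOL-Probability.Probability" "Jordan_Normal_Form.VS_Connect"
begin

record 'e matroid_data =
  ground :: "'e set"
  indeps :: "'e set set"

locale matroid =
  fixes M :: "'e matroid_data"
  assumes finite_ground: "finite (ground M)"
    and indeps_subset: "I \<in> indeps M \<Longrightarrow> I \<subseteq> ground M"
    and empty_indep: "{} \<in> indeps M"
    and indep_mono: "\<lbrakk>I \<in> indeps M; J \<subseteq> I\<rbrakk> \<Longrightarrow> J \<in> indeps M"
    and augment: "\<lbrakk>I \<in> indeps M; J \<in> indeps M; card I < card J\<rbrakk>
      \<Longrightarrow> \<exists>x\<in>J - I. insert x I \<in> indeps M"

definition free_matroid :: "'e matroid_data \<Rightarrow> bool" where
  "free_matroid M \<longleftrightarrow> (\<forall>X\<subseteq>ground M. X \<in> indeps M)"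

definition matroid_iso :: "'e matroid_data \<Rightarrow> 'f matroid_data \<Rightarrow> bool" where
  "matroid_iso M N \<longleftrightarrow>
    (\<exists>f. bij_betw f (ground M) (ground N) \<and>
         (\<forall>X\<subseteq>ground M. X \<in> indeps M \<longleftrightarrow> f ` X \<in> indeps N))"

definition matroid_delete :: "'e matroid_data \<Rightarrow> 'e set \<Rightarrow> 'e matroid_data" where
  "matroid_delete M X =
    \<lparr>ground = ground M - X, indeps = {I \<in> indeps M. I \<subseteq> ground M - X}\<rparr>"

definition matroid_basis_of :: "'e matroid_data \<Rightarrow> 'e set \<Rightarrow> 'e set \<Rightarrow> bool" where
  "matroid_basis_of M X B \<longleftrightarrow>
    B \<in> indeps M \<and> B \<subseteq> X \<and> (\<forall>I\<in>indeps M. B \<subseteq> I \<and> I \<subseteq> X \<longrightarrow> I = B)"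

(* In a matroid, whether the union of I and B is independent does not depend on which
   basis B of X is taken. *)
definition matroid_contract :: "'e matroid_data \<Rightarrow> 'e set \<Rightarrow> 'e matroid_data" where
  "matroid_contract M X =
    \<lparr>ground = ground M - X,
     indeps = {I. I \<subseteq> ground M - X \<and> (\<exists>B. matroid_basis_of M X B \<and> I \<union> B \<in> indeps M)}\<rparr>"

inductive minor_step :: "'e matroid_data \<Rightarrow> 'e matroid_data \<Rightarrow> bool" where
  delete_step: "X \<subseteq> ground N \<Longrightarrow> minor_step N (matroid_delete N X)"
| contract_step: "X \<subseteq> ground N \<Longrightarrow> minor_step N (matroid_contract N X)"

definition is_minor :: "'e matroid_data \<Rightarrow> 'f matroid_data \<Rightarrow> bool" where
  "is_minor M N \<longleftrightarrow> (\<exists>N'. minor_step\<^sup>*\<^sup>* N N' \<and> matroid_iso M N')"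

(* Columns are numbered from 0. The library's linear (in)dependence is a property of sets of
   vectors; injectivity of the column map on I makes it a property of the family of columns,
   so that repeated columns are dependent. *)
definition column_matroid :: "'a::field mat \<Rightarrow> nat matroid_data" where
  "column_matroid A =
    \<lparr>ground = {..<dim_col A},
     indeps = {I. I \<subseteq> {..<dim_col A} \<and> inj_on (col A) I \<and>
       \<not> module.lin_dep class_ring (module_vec TYPE('a) (dim_row A)) (col A ` I)}\<rparr>"

definition representable_over :: "'a::field itself \<Rightarrow> 'e matroid_data \<Rightarrow> bool" where
  "representable_over _ M \<longleftrightarrow> (\<exists>A :: 'a mat. matroid_iso M (column_matroid A))"

definition uniform_mat :: "nat \<Rightarrow> nat \<Rightarrow> 'a::{field,finite} mat pmf" where
  "uniform_mat m n = pmf_of_set (carrier_mat m n)"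

(* The index is shifted, so that the product starts with the factor 1 - 1/q. *)
definition C_const :: "nat \<Rightarrow> real" where
  "C_const q = (\<Prod>k. 1 - inverse (real q ^ Suc k))"

(* Needed for the uniform distribution above to be the intended one. *)
lemma finite_carrier_mat: "finite (carrier_mat m n :: 'a::{field,finite} mat set)"
proof (rule finite_subset)
  let ?F = "PiE ({..<m} \<times> {..<n}) (\<lambda>_. UNIV :: 'a set)"
  show "carrier_mat m n \<subseteq> (\<lambda>f. mat m n f) ` ?F"
  proof
    fix A :: "'a mat" assume "A \<in> carrier_mat m n"
    then have "A = mat m n (restrict (\<lambda>ij. A $$ ij) ({..<m} \<times> {..<n}))"
      by (intro eq_matI) auto
    moreover have "restrict (\<lambda>ij. A $$ ij) ({..<m} \<times> {..<n}) \<in> ?F" by auto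
    ultimately show "A \<in> (\<lambda>f. mat m n f) ` ?F" by blast
  qed
  show "finite ((\<lambda>f. mat m n f) ` ?F)" by (intro finite_imageI finite_PiE) auto
qed

lemma set_pmf_uniform_mat: "set_pmf (uniform_mat m n :: 'a::{field,finite} mat pmf) = carrier_mat m n"
  unfolding uniform_mat_def
  by (intro set_pmf_of_set finite_carrier_mat) (use zero_carrier_mat in blast)

lemma C_const_convergent:
  assumes "q \<ge> 2"
  shows "convergent_prod (\<lambda>k. 1 - inverse (real q ^ Suc k))"
proof -
  have "summable (\<lambda>k. inverse (real q) ^ Suc k)"
    using assms by (subst summable_Suc_iff) (auto intro!: summable_geometric simp: divide_simps)
  then have "abs_convergent_prod (\<lambda>k. 1 - inverse (real q ^ Suc k))"
    by (subst abs_convergent_prod_conv_summable) (simp add: power_inverse)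
  then show ?thesis by (rule abs_convergent_prod_imp_convergent_prod)
qed

end

theory Submission
  imports Defs
begin

text \<open>A minor of a free matroid is free, so a non-free matroid is never a minor of
  \<open>M[A]\<close> when the columns of \<open>A\<close> are linearly independent. Choosing the columns one after
  another, each outside the span of its predecessors, gives at least
  \<open>\<Prod>i<n. q^m - q^i\<close> such matrices, a proportion of at least
  \<open>\<Prod>k<n. 1 - q^(-(k+1)) \<ge> C\<^sub>q\<close> once \<open>m \<ge> n\<close>.\<close>

lemma free_matroid_delete:
  assumes "free_matroid N"
  shows "free_matroid (matroid_delete N X)"
  using assms unfolding free_matroid_def matroid_delete_def by auto

text \<open>In a free matroid \<open>X\<close> is a basis of itself, so contraction tests the
  independence of \<open>I \<union> X\<close>, again a subset of the ground set.\<close>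

lemma free_matroid_contract:
  assumes "free_matroid N" and X: "X \<subseteq> ground N"
  shows "free_matroid (matroid_contract N X)"
proof -
  have indep: "I \<in> indeps N" if "I \<subseteq> ground N" for I
    using assms(1) that unfolding free_matroid_def by blast
  have "matroid_basis_of N X X"
    unfolding matroid_basis_of_def using indep[OF X] by auto
  moreover have "I \<union> X \<in> indeps N" if "I \<subseteq> ground N - X" for I
    using indep[of "I \<union> X"] that X by auto
  ultimately show ?thesis
    unfolding free_matroid_def matroid_contract_def by auto
qed

lemma free_matroid_minor_steps:
  assumes "minor_step\<^sup>*\<^sup>* N N'" and "free_matroid N"
  shows "free_matroid N'"
  using assms
  by (induction rule: rtranclp_induct)
    (auto elim!: minor_step.cases simp: free_matroid_delete free_matroid_contract)

lemma free_matroid_iso: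
  assumes "matroid_iso M N" and "free_matroid N"
  shows "free_matroid M"
proof -
  obtain f where f: "bij_betw f (ground M) (ground N)"
    and iff: "\<And>X. X \<subseteq> ground M \<Longrightarrow> X \<in> indeps M \<longleftrightarrow> f ` X \<in> indeps N"
    using assms(1) unfolding matroid_iso_def by blast
  have "f ` X \<subseteq> ground N" if "X \<subseteq> ground M" for X
    using bij_betw_imp_surj_on[OF f] that by blast
  with iff assms(2) show ?thesis unfolding free_matroid_def by blast
qed

lemma free_matroid_minor:
  assumes "is_minor M N" and "free_matroid N"
  shows "free_matroid M"
  using assms free_matroid_minor_steps free_matroid_iso unfolding is_minor_def by blast

text \<open>Finiteness of the field is a hypothesis and not a sort constraint, so that the count
  applies inside \<open>vec_space\<close>, where \<open>'a\<close> is fixed with sort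
  \<open>field\<close>.\<close>

lemma card_carrier_vec:
  assumes "finite (UNIV :: 'a set)"
  shows "card (carrier_vec n :: 'a vec set) = CARD('a) ^ n"
proof -
  have "bij_betw list_of_vec (carrier_vec n :: 'a vec set) {xs. set xs \<subseteq> UNIV \<and> length xs = n}"
    by (rule bij_betw_byWitness[where f' = vec_of_list])
      (auto simp: vec_list list_vec intro!: carrier_vecI)
  then show ?thesis
    using card_lists_length_eq[OF assms, of n] by (simp add: bij_betw_same_card)
qed

lemma finite_carrier_vec:
  assumes "finite (UNIV :: 'a set)"
  shows "finite (carrier_vec n :: 'a vec set)"
  by (rule card_ge_0_finite) (simp add: card_carrier_vec assms finite_UNIV_card_ge_0)

text \<open>With \<open>cols\<close> as inverse, matrices become lists of columns. This serves to
  count all matrices and to count those built from independent lists.\<close>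

lemma bij_betw_mat_of_cols:
  "bij_betw (mat_of_cols m) {us. set us \<subseteq> carrier_vec m \<and> length us = n} (carrier_mat m n)"
  by (rule bij_betw_byWitness[where f' = cols]) (auto dest: subsetD[OF cols_dim])

lemma card_carrier_mat:
  "card (carrier_mat m n :: 'a::finite mat set) = (CARD('a) ^ m) ^ n"
  using bij_betw_same_card[OF bij_betw_mat_of_cols[of m n, where 'a = 'a]]
    card_lists_length_eq[OF finite_carrier_vec[of m, where 'a = 'a], of n]
  by (simp add: card_carrier_vec)

context vec_space
begin

text \<open>Lists, because the order of columns matters. Since \<open>lin_indpt\<close> is a
  property of sets, \<open>distinct\<close> turns it into independence of the family. The ambient
  dimension is the locale parameter \<open>n\<close>; \<open>k\<close> counts the vectors.\<close>

definition indep_lists :: "nat \<Rightarrow> 'a vec list set" where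
  "indep_lists k =
    {us. length us = k \<and> set us \<subseteq> carrier_vec n \<and> distinct us \<and> lin_indpt (set us)}"

lemma card_span_le:
  assumes "finite (UNIV :: 'a set)" "finite S" "S \<subseteq> carrier_vec n"
  shows "card (span S) \<le> CARD('a) ^ card S"
proof -
  let ?F = "PiE S (\<lambda>_. UNIV :: 'a set)"
  have fin: "finite ?F" using assms by (intro finite_PiE) auto
  have "span S \<subseteq> (\<lambda>a. lincomb a S) ` ?F"
  proof
    fix v assume "v \<in> span S"
    then obtain a where "v = lincomb a S"
      using finite_span[OF assms(2)] assms(3) by auto
    \<comment> \<open>\<open>lincomb\<close> reads coefficients on \<open>S\<close> only, so the
      restricted function, a member of the finite set \<open>?F\<close>, gives the same
      vector.\<close>
    also have "\<dots> = lincomb (restrict a S) S"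
      by (rule lincomb_cong) (use assms in auto)
    finally show "v \<in> (\<lambda>a. lincomb a S) ` ?F" by auto
  qed
  then have "card (span S) \<le> card ?F"
    using fin by (rule surj_card_le[rotated])
  then show ?thesis using assms(2) by (simp add: card_PiE)
qed

text \<open>Avoiding the span yields both conditions on the longer list: \<open>v\<close> is not a
  repetition, because a set lies in its own span, and adding it keeps independence.\<close>

lemma indep_lists_Cons:
  assumes "us \<in> indep_lists k" and "v \<in> carrier_vec n - span (set us)"
  shows "v # us \<in> indep_lists (Suc k)"
proof -
  have us: "set us \<subseteq> carrier_vec n" "lin_indpt (set us)"
    using assms(1) by (auto simp: indep_lists_def)
  have "v \<notin> set us" using assms(2) in_own_span[of "set us"] us(1) by auto
  then show ?thesis
    using assms lin_dep_iff_in_span[of "set us" v] us by (auto simp: indep_lists_def)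
qed

text \<open>An independent list of length \<open>k\<close> spans at most \<open>q^k\<close> vectors,
  which leaves at least \<open>q^n - q^k\<close> extensions. Subtraction is truncated: for
  \<open>k > n\<close> the factor at \<open>i = n\<close> is 0 and the bound is trivial.\<close>

lemma card_indep_lists_ge:
  assumes "finite (UNIV :: 'a set)"
  shows "(\<Prod>i<k. CARD('a) ^ n - CARD('a) ^ i) \<le> card (indep_lists k)"
proof (induction k)
  case 0
  have "indep_lists 0 = {[]}"
    by (auto simp: indep_lists_def lin_dep_def)
  then show ?case by simp
next
  case (Suc k)
  let ?q = "CARD('a)"
  note fin = finite_carrier_vec[OF assms, of n]
  let ?S = "SIGMA us : indep_lists k. carrier_vec n - span (set us)"
  have finL: "finite (indep_lists j)" for j
    by (rule finite_subset[OF _ finite_lists_length_eq[OF fin, of j]])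
      (auto simp: indep_lists_def)
  have new: "?q ^ n - ?q ^ k \<le> card (carrier_vec n - span (set us))" if "us \<in> indep_lists k" for us
  proof -
    have us: "set us \<subseteq> carrier_vec n" "card (set us) = k"
      using that by (auto simp: indep_lists_def distinct_card)
    have "finite (span (set us))" using span_is_subset2[OF us(1)] fin by (rule finite_subset)
    then have "card (carrier_vec n :: 'a vec set) - card (span (set us))
        \<le> card (carrier_vec n - span (set us))"
      by (rule diff_card_le_card_Diff)
    moreover have "card (span (set us)) \<le> ?q ^ k"
      using card_span_le[OF assms _ us(1)] us(2) by simp
    ultimately show ?thesis using card_carrier_vec[OF assms] by simp
  qed
  have "(\<Prod>i<Suc k. ?q ^ n - ?q ^ i) \<le> card (indep_lists k) * (?q ^ n - ?q ^ k)"
    using Suc by simp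
  also have "\<dots> \<le> (\<Sum>us\<in>indep_lists k. card (carrier_vec n - span (set us)))"
    using sum_bounded_below[of "indep_lists k" "?q ^ n - ?q ^ k"] new by simp
  also have "\<dots> = card ?S"
    using finL fin by (simp add: card_SigmaI)
  \<comment> \<open>The new list determines both the old list and the added vector, so no extension
    is counted twice.\<close>
  also have "\<dots> = card ((\<lambda>(us, v). v # us) ` ?S)"
    by (rule card_image[symmetric]) (auto simp: inj_on_def)
  also have "\<dots> \<le> card (indep_lists (Suc k))"
    using indep_lists_Cons by (intro card_mono finL) auto
  finally show ?case .
qed

text \<open>Independence passes to subsets, so independence of all columns together settles every
  index set; distinctness gives injectivity of the column map.\<close>

lemma free_matroid_mat_of_cols:
  assumes "us \<in> indep_lists k"
  shows "free_matroid (column_matroid (mat_of_cols n us))"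
proof -
  let ?A = "mat_of_cols n us"
  have us: "length us = k" "set us \<subseteq> carrier_vec n" "distinct us" "lin_indpt (set us)"
    using assms by (auto simp: indep_lists_def)
  have col: "col ?A j = us ! j" if "j < k" for j
    using us that by (metis col_mat_of_cols nth_mem subsetD)
  have "I \<subseteq> {..<k} \<Longrightarrow> inj_on (col ?A) I \<and> lin_indpt (col ?A ` I)" for I
  proof
    assume I: "I \<subseteq> {..<k}"
    show "inj_on (col ?A) I"
      using I col us by (auto simp: inj_on_def nth_eq_iff_index_eq subset_iff)
    have "col ?A ` I \<subseteq> set us" using I col us(1) by (auto simp: subset_iff)
    then show "lin_indpt (col ?A ` I)" using us(4) subset_li_is_li by blast
  qed
  then show ?thesis
    using us(1) by (simp add: free_matroid_def column_matroid_def)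
qed

end

lemma prob_free_matroid_ge:
  assumes "n \<le> m"
  shows "(\<Prod>i<n. 1 - real CARD('a) ^ i / real CARD('a) ^ m)
    \<le> measure_pmf.prob (uniform_mat m n :: 'a::{field,finite} mat pmf)
        {A. free_matroid (column_matroid A)}"
proof -
  \<comment> \<open>Columns live in dimension \<open>m\<close>, so the locale parameter
    \<open>n\<close> is instantiated by the number of rows, while \<open>n\<close> below is the
    number of columns.\<close>
  interpret vec_space "TYPE('a)" m .
  let ?q = "CARD('a)" and ?Fr = "{A :: 'a mat. free_matroid (column_matroid A)}"
  have q: "?q \<ge> 1" by (simp add: Suc_leI)
  have "(\<Prod>i<n. ?q ^ m - ?q ^ i) \<le> card (indep_lists n)"
    by (rule card_indep_lists_ge) simp
  also have "\<dots> = card (mat_of_cols m ` indep_lists n)"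
    by (rule card_image[symmetric],
        rule inj_on_subset[OF bij_betw_imp_inj_on[OF bij_betw_mat_of_cols[of m n]]])
      (auto simp: indep_lists_def)
  also have "\<dots> \<le> card (carrier_mat m n \<inter> ?Fr)"
    by (rule card_mono)
      (auto simp: finite_carrier_mat free_matroid_mat_of_cols, auto simp: indep_lists_def)
  finally have "real (\<Prod>i<n. ?q ^ m - ?q ^ i) / (real ?q ^ m) ^ n
      \<le> card (carrier_mat m n \<inter> ?Fr) / (real ?q ^ m) ^ n"
    by (intro divide_right_mono) (simp_all only: of_nat_le_iff, simp)
  also have "\<dots> = measure_pmf.prob (uniform_mat m n) ?Fr"
    unfolding uniform_mat_def using zero_carrier_mat
    by (subst measure_pmf_of_set) (auto simp: finite_carrier_mat card_carrier_mat)
  \<comment> \<open>Since \<open>i < n \<le> m\<close>, no natural subtraction truncates, and each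
    agrees with the real one.\<close>
  also have "real (\<Prod>i<n. ?q ^ m - ?q ^ i) / (real ?q ^ m) ^ n
      = (\<Prod>i<n. (real ?q ^ m - real ?q ^ i) / real ?q ^ m)"
    using assms q by (simp add: prod_dividef of_nat_diff power_increasing)
  also have "\<dots> = (\<Prod>i<n. 1 - real ?q ^ i / real ?q ^ m)"
    by (simp add: diff_divide_distrib)
  finally show ?thesis .
qed

text \<open>All factors lie in [0, 1], so the partial products decrease to their limit
  \<open>C_const q\<close> and stay above it.\<close>

lemma C_const_le:
  assumes "q \<ge> 2"
  shows "C_const q \<le> (\<Prod>k<n. 1 - inverse (real q ^ Suc k))"
proof -
  let ?f = "\<lambda>k. 1 - inverse (real q ^ Suc k)"
  have "1 \<le> real q ^ Suc k" for k using assms by (intro one_le_power) simp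
  then have "inverse (real q ^ Suc k) \<le> 1" for k
    by (subst inverse_le_1_iff) blast
  then have f: "0 \<le> ?f k" "?f k \<le> 1" for k
    by (simp_all del: power_Suc)
  have "decseq (\<lambda>n. \<Prod>k<n. ?f k)"
    by (rule decseq_SucI) (use f in \<open>auto intro!: mult_left_le prod_nonneg simp del: power_Suc\<close>)
  moreover have "(\<lambda>n. \<Prod>k<n. ?f k) \<longlonglongrightarrow> C_const q"
    unfolding C_const_def
    using convergent_prod_LIMSEQ[OF C_const_convergent[OF assms]]
    by (subst LIMSEQ_lessThan_iff_atMost)
  ultimately show ?thesis by (rule decseq_ge)
qed

lemma C_const_le_prob_free_matroid:
  assumes "n \<le> m"
  shows "C_const CARD('a)
    \<le> measure_pmf.prob (uniform_mat m n :: 'a::{field,finite} mat pmf)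
        {A. free_matroid (column_matroid A)}"
proof -
  let ?q = "real CARD('a)"
  have "card {0, 1 :: 'a} \<le> CARD('a)" by (rule card_mono) auto
  then have q: "CARD('a) \<ge> 2" by simp
  then have "1 \<le> ?q" by simp
  have "C_const CARD('a) \<le> (\<Prod>k<n. 1 - inverse (?q ^ Suc k))"
    by (rule C_const_le[OF q])
  \<comment> \<open>Reverse the order of the factors: \<open>k = n - Suc i\<close> makes the
    exponent \<open>Suc k\<close> equal to \<open>n - i\<close>.\<close>
  also have "\<dots> = (\<Prod>i<n. 1 - inverse (?q ^ (n - i)))"
    by (subst prod.nat_diff_reindex[symmetric]) (auto intro!: prod.cong simp: Suc_diff_Suc simp del: power_Suc)
  \<comment> \<open>Factor by factor: \<open>n \<le> m\<close> gives
    \<open>m - i \<ge> n - i\<close>, so less is subtracted on the right.\<close>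
  also have "\<dots> \<le> (\<Prod>i<n. 1 - ?q ^ i / ?q ^ m)"
  proof (rule prod_mono, intro conjI)
    fix i assume "i \<in> {..<n}"
    then have i: "i < n" by simp
    have "1 \<le> ?q ^ (n - i)" by (rule one_le_power) fact
    then show "0 \<le> 1 - inverse (?q ^ (n - i))" by (simp add: inverse_le_1_iff)
    have "?q ^ i / ?q ^ m = inverse (?q ^ (m - i))"
      using i assms by (simp add: power_diff field_simps)
    also have "\<dots> \<le> inverse (?q ^ (n - i))"
      using \<open>1 \<le> ?q\<close> assms by (intro le_imp_inverse_le power_increasing) auto
    finally show "1 - inverse (?q ^ (n - i)) \<le> 1 - ?q ^ i / ?q ^ m" by simp
  qed
  also note prob_free_matroid_ge[OF assms]
  finally show ?thesis .
qed

theorem theorem5: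
  fixes M :: "'e matroid_data" and m :: "nat \<Rightarrow> nat"
  assumes "matroid M"
    and "\<not> free_matroid M"
    and "representable_over TYPE('a::{field,finite}) M"
    and "\<forall>\<^sub>F n in sequentially. m n \<ge> n"
  shows "limsup (\<lambda>n. ereal (measure_pmf.prob (uniform_mat (m n) n :: 'a mat pmf)
            {A. is_minor M (column_matroid A)}))
         \<le> ereal (1 - C_const CARD('a))"
proof (rule Limsup_bounded)
  show "\<forall>\<^sub>F n in sequentially. ereal (measure_pmf.prob (uniform_mat (m n) n :: 'a mat pmf)
      {A. is_minor M (column_matroid A)}) \<le> ereal (1 - C_const CARD('a))"
    using assms(4)
  proof eventually_elim
    case (elim n)
    let ?P = "measure_pmf.prob (uniform_mat (m n) n :: 'a mat pmf)"
    let ?Fr = "{A. free_matroid (column_matroid A)}"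
    \<comment> \<open>As \<open>M\<close> is not free, any column matroid having it as a minor is
      not free either.\<close>
    have "?P {A. is_minor M (column_matroid A)} \<le> ?P (- ?Fr)"
      using free_matroid_minor assms(2) by (intro measure_pmf.finite_measure_mono) auto
    also have "\<dots> = 1 - ?P ?Fr"
      using measure_pmf.prob_compl[of ?Fr "uniform_mat (m n) n :: 'a mat pmf"]
      by (simp add: Compl_eq_Diff_UNIV)
    also have "\<dots> \<le> 1 - C_const CARD('a)"
      using C_const_le_prob_free_matroid[OF elim, where 'a = 'a] by simp
    finally show ?case by simp
  qed
qed

end
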